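(* Let $n\ge 1$ and $s\ge 2$ be integers, let $Z=\{z_1,\dots,z_s\}\subset B_2^n\subset\mathbb{R}^n$ be a set of $s$ distinct points, and let $N\ge s-1$ be an integer. Then for each $j\in\{1,\dots,s\}$ there exists a polynomial $Q_j\in\mathcal{P}_N^n$ with $Q_j(z_i)=\delta_{ij}$ for all $i=1,\dots,s$ and $$\|Q_j\|_\infty\le s\left(\frac{4n}{\rho(Z,j)}\right)^{s-1}.$$
   Context: $B_2^n=\{x\in\mathbb{R}^n:\|x\|_2\le 1\}$ is the closed Euclidean unit ball. $\mathcal{P}_N^n$ is the space of real polynomials in $n$ variables of total degree at most $N$. For $P(z)=\sum_{|\alpha|\le N}a_\alpha z^\alpha\in\mathcal{P}_N^n$ (multi-indices $\alpha\in\mathbb{Z}_{\ge0}^n$, $|\alpha|=\sum_\ell\alpha_\ell$, $z^\alpha=\prod_\ell z_\ell^{\alpha_\ell}$), the norm is the coefficient norm $\|P\|_\infty=\max_{|\alpha|\le N}|a_\alpha|$. $\delta_{ij}$ is the Kronecker delta. The max–min projection separation is $\rho(Z,j)=\max_{\|v\|_2=1}\min_{i\ne j}|\langle v,z_j-z_i\rangle|$, the maximum being over $v\in\mathbb{R}^n$; it is positive since the points are distinct. *)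

theory Defs
  imports "HOL-Analysis.Analysis" "HOL-Library.Poly_Mapping"
begin

text \<open>
  A multi-index is a vector in \<^typ>\<open>nat ^ 'n\<close>, the dimension being \<open>n = CARD('n)\<close>, and a
  real polynomial in \<open>n\<close> variables is a finitely supported family of coefficients, indexed by
  multi-indices. With the convolution product of \<open>HOL-Library.Poly_Mapping\<close>, the type below is
  the polynomial ring.
\<close>

type_synonym 'n multi_index = "nat ^ 'n"
type_synonym 'n real_mpoly = "(nat ^ 'n) \<Rightarrow>\<^sub>0 real"

definition mdeg :: "'n::finite multi_index \<Rightarrow> nat" where
  "mdeg \<alpha> = (\<Sum>l\<in>UNIV. \<alpha> $ l)"

definition mpower :: "real ^ 'n::finite \<Rightarrow> 'n multi_index \<Rightarrow> real" where
  "mpower x \<alpha> = (\<Prod>l\<in>UNIV. (x $ l) ^ (\<alpha> $ l))"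

definition mpoly_eval :: "'n::finite real_mpoly \<Rightarrow> real ^ 'n \<Rightarrow> real" where
  "mpoly_eval P x = (\<Sum>\<alpha>\<in>Poly_Mapping.keys P. Poly_Mapping.lookup P \<alpha> * mpower x \<alpha>)"

definition mpoly_space :: "nat \<Rightarrow> 'n::finite real_mpoly set" where
  "mpoly_space N = {P. \<forall>\<alpha>\<in>Poly_Mapping.keys P. mdeg \<alpha> \<le> N}"

lemma finite_mdeg_le: "finite {\<alpha> :: 'n::finite multi_index. mdeg \<alpha> \<le> N}"
proof -
  have "\<alpha> $ l \<le> N" if "mdeg \<alpha> \<le> N" for \<alpha> :: "'n multi_index" and l
    using that member_le_sum[of l UNIV "\<lambda>l. \<alpha> $ l"] by (simp add: mdeg_def)
  then have "{\<alpha> :: 'n multi_index. mdeg \<alpha> \<le> N} \<subseteq> vec_lambda ` (PiE UNIV (\<lambda>_. {..N}))"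
    by (intro subsetI, rule_tac x = "vec_nth x" in image_eqI) auto
  then show ?thesis
    by (rule finite_subset) (intro finite_imageI finite_PiE; simp)
qed

text \<open>
  The norm on \<open>mpoly_space N\<close>; the index set of the maximum is finite by \<open>finite_mdeg_le\<close>
  and contains \<open>0\<close>.
\<close>

definition coeff_norm :: "nat \<Rightarrow> 'n::finite real_mpoly \<Rightarrow> real" where
  "coeff_norm N P = Max ((\<lambda>\<alpha>. \<bar>Poly_Mapping.lookup P \<alpha>\<bar>) ` {\<alpha>. mdeg \<alpha> \<le> N})"

definition min_proj :: "(nat \<Rightarrow> real ^ 'n::finite) \<Rightarrow> nat \<Rightarrow> nat \<Rightarrow> real ^ 'n \<Rightarrow> real" where
  "min_proj z s j v = Min ((\<lambda>i. \<bar>v \<bullet> (z j - z i)\<bar>) ` ({1..s} - {j}))"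

text \<open>
  The outer maximum ranges over the unit sphere, an infinite set for \<open>n \<ge> 2\<close>, so it is written
  as a supremum. It is attained when \<open>s \<ge> 2\<close>: see \<open>proj_sep_attained\<close>.
\<close>

definition proj_sep :: "(nat \<Rightarrow> real ^ 'n::finite) \<Rightarrow> nat \<Rightarrow> nat \<Rightarrow> real" where
  "proj_sep z s j = (SUP v\<in>{v. norm v = 1}. min_proj z s j v)"

lemma continuous_on_Min_image:
  fixes f :: "'i \<Rightarrow> 'a::topological_space \<Rightarrow> real"
  assumes "finite I" "I \<noteq> {}" "\<And>i. i \<in> I \<Longrightarrow> continuous_on S (f i)"
  shows "continuous_on S (\<lambda>v. Min ((\<lambda>i. f i v) ` I))"
  using assms
proof (induction I rule: finite_ne_induct)
  case (insert i I)
  then show ?case by (simp add: continuous_on_min)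
qed simp

lemma proj_sep_attained:
  fixes z :: "nat \<Rightarrow> real ^ 'n::finite"
  assumes "s \<ge> 2"
  shows "\<exists>v. norm v = 1 \<and> proj_sep z s j = min_proj z s j v
             \<and> (\<forall>w. norm w = 1 \<longrightarrow> min_proj z s j w \<le> min_proj z s j v)"
proof -
  let ?S = "{v :: real ^ 'n. norm v = 1}"
  have S: "?S = sphere 0 1" by (simp add: sphere_def)
  have "card ({1..s} - {j}) \<noteq> 0"
    using assms by (simp add: card_Diff_singleton_if)
  then have ne: "{1..s} - {j} \<noteq> {}" by (metis card.empty)
  have "continuous_on ?S (min_proj z s j)"
    unfolding min_proj_def
    by (rule continuous_on_Min_image[OF _ ne]) (simp, intro continuous_intros)
  moreover have "compact ?S"
    unfolding S by (rule compact_sphere)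
  moreover have "?S \<noteq> {}"
    unfolding S by simp
  ultimately obtain v where v: "v \<in> ?S" "\<And>w. w \<in> ?S \<Longrightarrow> min_proj z s j w \<le> min_proj z s j v"
    using continuous_attains_sup[of ?S "min_proj z s j"] by blast
  then have "proj_sep z s j = min_proj z s j v"
    unfolding proj_sep_def by (intro cSup_eq_maximum) auto
  with v show ?thesis by auto
qed

end

theory Submission imports Defs begin

text \<open>
  Choose a unit vector \<open>v\<close> realising \<open>\<rho>(Z, j)\<close> and interpolate along the line spanned by \<open>v\<close>:
  \<open>Q\<^sub>j(x) = (\<Prod>i\<noteq>j. \<langle>v, x - z\<^sub>i\<rangle> / \<langle>v, z\<^sub>j - z\<^sub>i\<rangle>)\<close>. The sum of the absolute values of the
  coefficients is submultiplicative, dominates the coefficient norm, and is at most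
  \<open>2 n / \<rho>(Z, j)\<close> for each of the \<open>s - 1\<close> factors. Positivity of \<open>\<rho>(Z, j)\<close> holds because
  finitely many hyperplanes do not cover \<open>\<real>\<^sup>n\<close>.
\<close>

text \<open>Reduces a product to sums of monomials, so that multiplicativity of evaluation and
  submultiplicativity of \<open>l1_norm\<close> follow from their behaviour on sums and on
  \<open>single\<close>.\<close>

lemma poly_mapping_times_expand:
  fixes P Q :: "'a::monoid_add \<Rightarrow>\<^sub>0 'b::semiring_0"
  shows "P * Q = (\<Sum>a\<in>Poly_Mapping.keys P. \<Sum>b\<in>Poly_Mapping.keys Q.
           Poly_Mapping.single (a + b) (Poly_Mapping.lookup P a * Poly_Mapping.lookup Q b))"
proof -
  have expand: "R = (\<Sum>a\<in>Poly_Mapping.keys R. Poly_Mapping.single a (Poly_Mapping.lookup R a))"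
    for R :: "'a \<Rightarrow>\<^sub>0 'b"
    by (rule poly_mapping_eqI)
       (simp add: lookup_sum lookup_single when_def sum.delta in_keys_iff)
  have "P * Q = (\<Sum>a\<in>Poly_Mapping.keys P. Poly_Mapping.single a (Poly_Mapping.lookup P a)) *
      (\<Sum>b\<in>Poly_Mapping.keys Q. Poly_Mapping.single b (Poly_Mapping.lookup Q b))"
    using expand[of P] expand[of Q] by metis
  then show ?thesis
    by (simp add: sum_product mult_single)
qed

section \<open>Monomials, degrees and evaluation\<close>

lemma mpower_0 [simp]: "mpower x 0 = 1"
  by (simp add: mpower_def)

lemma mpower_add: "mpower x (\<alpha> + \<beta>) = mpower x \<alpha> * mpower x \<beta>"
  by (simp add: mpower_def power_add prod.distrib)

lemma mpower_axis [simp]: "mpower x (axis l 1) = x $ l"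
proof -
  have "mpower x (axis l 1) = (\<Prod>k\<in>UNIV. if k = l then x $ k else 1)"
    unfolding mpower_def by (intro prod.cong) (auto simp: axis_def)
  then show ?thesis by simp
qed

lemma mdeg_0 [simp]: "mdeg 0 = 0"
  by (simp add: mdeg_def)

lemma mdeg_add: "mdeg (\<alpha> + \<beta>) = mdeg \<alpha> + mdeg \<beta>"
  by (simp add: mdeg_def sum.distrib)

lemma mdeg_axis [simp]: "mdeg (axis l k) = k"
  by (simp add: mdeg_def axis_def)

text \<open>Coefficients outside the support vanish. The free choice of \<open>A\<close> gives
  \<open>P\<close>, \<open>Q\<close> and \<open>P + Q\<close> a common index set, and covers
  \<open>single\<close> with coefficient 0, whose support is empty.\<close>

lemma mpoly_eval_eq_sum:
  assumes "finite A" "Poly_Mapping.keys P \<subseteq> A"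
  shows "mpoly_eval P x = (\<Sum>\<alpha>\<in>A. Poly_Mapping.lookup P \<alpha> * mpower x \<alpha>)"
  unfolding mpoly_eval_def using assms
  by (intro sum.mono_neutral_left) (auto simp: in_keys_iff)

lemma mpoly_eval_0 [simp]: "mpoly_eval 0 x = 0"
  by (simp add: mpoly_eval_def)

lemma mpoly_eval_single [simp]: "mpoly_eval (Poly_Mapping.single \<alpha> c) x = c * mpower x \<alpha>"
  by (subst mpoly_eval_eq_sum[of "{\<alpha>}"]) auto

lemma mpoly_eval_1 [simp]: "mpoly_eval 1 x = 1"
  using mpoly_eval_single[of 0 1 x] by (simp del: mpoly_eval_single)

lemma mpoly_eval_add: "mpoly_eval (P + Q) x = mpoly_eval P x + mpoly_eval Q x"
proof -
  let ?A = "Poly_Mapping.keys P \<union> Poly_Mapping.keys Q"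
  have "Poly_Mapping.keys (P + Q) \<subseteq> ?A" by (rule Poly_Mapping.keys_add)
  then show ?thesis
    by (simp add: mpoly_eval_eq_sum[of ?A] lookup_add distrib_right sum.distrib)
qed

lemma mpoly_eval_sum: "mpoly_eval (\<Sum>i\<in>I. P i) x = (\<Sum>i\<in>I. mpoly_eval (P i) x)"
  by (induction I rule: infinite_finite_induct) (simp_all add: mpoly_eval_add)

lemma mpoly_eval_mult: "mpoly_eval (P * Q) x = mpoly_eval P x * mpoly_eval Q x"
  by (simp add: poly_mapping_times_expand mpoly_eval_sum mpower_add mpoly_eval_def[of P]
      mpoly_eval_def[of Q] sum_product mult.commute mult.left_commute)

lemma mpoly_eval_prod: "mpoly_eval (\<Prod>i\<in>I. P i) x = (\<Prod>i\<in>I. mpoly_eval (P i) x)"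
  by (induction I rule: infinite_finite_induct) (simp_all add: mpoly_eval_mult)

section \<open>Degree bounds for products\<close>

lemma mpoly_space_mono: "M \<le> N \<Longrightarrow> mpoly_space M \<subseteq> mpoly_space N"
  by (auto simp: mpoly_space_def)

lemma one_in_mpoly_space: "1 \<in> mpoly_space 0"
  by (simp add: mpoly_space_def flip: single_one)

lemma mpoly_space_mult:
  assumes "P \<in> mpoly_space M" "Q \<in> mpoly_space N"
  shows "P * Q \<in> mpoly_space (M + N)"
  using keys_mult[of P Q] assms by (fastforce simp: mpoly_space_def mdeg_add intro: add_mono)

lemma mpoly_space_prod:
  assumes "\<And>i. i \<in> I \<Longrightarrow> P i \<in> mpoly_space 1"
  shows "(\<Prod>i\<in>I. P i) \<in> mpoly_space (card I)"
  using assms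
proof (induction I rule: infinite_finite_induct)
  case (insert i I)
  then show ?case using mpoly_space_mult[of "P i" 1 "prod P I" "card I"] by simp
\<comment> \<open>For infinite \<open>I\<close> the product is 1 and the cardinality 0 by
  convention, exactly as for the empty set.\<close>
qed (simp_all add: one_in_mpoly_space)

section \<open>The sum of the absolute values of the coefficients\<close>

definition l1_norm :: "('a \<Rightarrow>\<^sub>0 real) \<Rightarrow> real" where
  "l1_norm P = (\<Sum>\<alpha>\<in>Poly_Mapping.keys P. \<bar>Poly_Mapping.lookup P \<alpha>\<bar>)"

lemma l1_norm_eq_sum:
  assumes "finite A" "Poly_Mapping.keys P \<subseteq> A"
  shows "l1_norm P = (\<Sum>\<alpha>\<in>A. \<bar>Poly_Mapping.lookup P \<alpha>\<bar>)"
  unfolding l1_norm_def using assms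
  by (intro sum.mono_neutral_left) (auto simp: in_keys_iff)

lemma l1_norm_0 [simp]: "l1_norm 0 = 0"
  by (simp add: l1_norm_def)

lemma l1_norm_nonneg: "0 \<le> l1_norm P"
  by (simp add: l1_norm_def sum_nonneg)

lemma l1_norm_single [simp]: "l1_norm (Poly_Mapping.single \<alpha> c) = \<bar>c\<bar>"
  by (subst l1_norm_eq_sum[of "{\<alpha>}"]) auto

lemma l1_norm_1 [simp]: "l1_norm 1 = 1"
  using l1_norm_single[of 0 1] by (simp del: l1_norm_single)

lemma l1_norm_add: "l1_norm (P + Q) \<le> l1_norm P + l1_norm Q"
proof -
  let ?A = "Poly_Mapping.keys P \<union> Poly_Mapping.keys Q"
  have "Poly_Mapping.keys (P + Q) \<subseteq> ?A" by (rule Poly_Mapping.keys_add)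
  then show ?thesis
    by (simp add: l1_norm_eq_sum[of ?A] lookup_add sum_mono flip: sum.distrib)
qed

lemma l1_norm_sum: "l1_norm (\<Sum>i\<in>I. P i) \<le> (\<Sum>i\<in>I. l1_norm (P i))"
  by (induction I rule: infinite_finite_induct) (auto intro: order_trans[OF l1_norm_add])

text \<open>Monomials \<open>a + b\<close> that coincide can only cancel, by the triangle
  inequality. The largest coefficient is not submultiplicative: squaring 1 + x raises it from 1 to
  2.\<close>

lemma l1_norm_mult:
  fixes P Q :: "'a::monoid_add \<Rightarrow>\<^sub>0 real"
  shows "l1_norm (P * Q) \<le> l1_norm P * l1_norm Q"
proof -
  have "l1_norm (P * Q) \<le> (\<Sum>a\<in>Poly_Mapping.keys P. \<Sum>b\<in>Poly_Mapping.keys Q.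
           \<bar>Poly_Mapping.lookup P a * Poly_Mapping.lookup Q b\<bar>)"
    unfolding poly_mapping_times_expand
    by (intro order_trans[OF l1_norm_sum] sum_mono) (simp add: order_trans[OF l1_norm_sum])
  also have "\<dots> = l1_norm P * l1_norm Q"
    by (simp add: l1_norm_def sum_product abs_mult)
  finally show ?thesis .
qed

lemma l1_norm_prod:
  fixes P :: "'i \<Rightarrow> 'a::comm_monoid_add \<Rightarrow>\<^sub>0 real"
  shows "l1_norm (\<Prod>i\<in>I. P i) \<le> (\<Prod>i\<in>I. l1_norm (P i))"
proof (induction I rule: infinite_finite_induct)
  case (insert i I)
  then show ?case
    by (auto intro!: order_trans[OF l1_norm_mult] mult_left_mono simp: l1_norm_nonneg)
qed simp_all

lemma coeff_norm_le_l1_norm: "coeff_norm N P \<le> l1_norm P"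
proof -
  have "\<bar>Poly_Mapping.lookup P \<alpha>\<bar> \<le> l1_norm P" for \<alpha>
    by (subst l1_norm_eq_sum[of "insert \<alpha> (Poly_Mapping.keys P)"])
       (auto intro!: member_le_sum)
  \<comment> \<open>\<open>Max\<close> is bounded by its elements only on a nonempty finite set; the
    zero multi-index supplies an element.\<close>
  moreover have "{\<alpha> :: 'a multi_index. mdeg \<alpha> \<le> N} \<noteq> {}"
    using mdeg_0 by (metis empty_Collect_eq zero_le)
  ultimately show ?thesis
    by (auto simp: coeff_norm_def finite_mdeg_le)
qed

section \<open>Affine polynomials, the factors of the interpolant\<close>

definition affine_mpoly :: "real ^ 'n::finite \<Rightarrow> real \<Rightarrow> 'n real_mpoly" where
  "affine_mpoly w c =
     (\<Sum>l\<in>UNIV. Poly_Mapping.single (axis l 1) (w $ l)) + Poly_Mapping.single 0 c"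

lemma mpoly_eval_affine [simp]: "mpoly_eval (affine_mpoly w c) x = w \<bullet> x + c"
  by (simp add: affine_mpoly_def mpoly_eval_add mpoly_eval_sum inner_vec_def del: One_nat_def)

lemma affine_in_mpoly_space: "affine_mpoly w c \<in> mpoly_space 1"
proof -
  have "Poly_Mapping.keys (affine_mpoly w c) \<subseteq> insert 0 (range (\<lambda>l. axis l 1))"
    unfolding affine_mpoly_def
    by (intro order_trans[OF Poly_Mapping.keys_add] Un_least order_trans[OF keys_sum] UN_least)
       auto
  then show ?thesis by (auto simp: mpoly_space_def)
qed

lemma l1_norm_affine: "l1_norm (affine_mpoly w c) \<le> (\<Sum>l\<in>UNIV. \<bar>w $ l\<bar>) + \<bar>c\<bar>"
proof -
  have "l1_norm (\<Sum>l\<in>UNIV. Poly_Mapping.single (axis l 1) (w $ l) :: 'a real_mpoly)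
          \<le> (\<Sum>l\<in>UNIV. \<bar>w $ l\<bar>)"
    by (rule order_trans[OF l1_norm_sum]) simp
  then show ?thesis
    unfolding affine_mpoly_def by (intro order_trans[OF l1_norm_add]) simp
qed

section \<open>Positivity of the projection separation\<close>

lemma exists_nonorthogonal_unit_vector:
  fixes A :: "'a::euclidean_space set"
  assumes "finite A" "0 \<notin> A"
  shows "\<exists>v. norm v = 1 \<and> (\<forall>a\<in>A. v \<bullet> a \<noteq> 0)"
proof -
  obtain e :: 'a where "e \<noteq> 0" using nonzero_Basis nonempty_Basis by blast
  \<comment> \<open>Adding a nonzero \<open>e\<close> forces the vector \<open>u\<close> below to be
    nonzero even when \<open>A\<close> is empty, so it can be normalised.\<close>
  let ?A = "insert e A"
  \<comment> \<open>Each hyperplane has Lebesgue measure zero, hence so does their finite union,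
    which therefore misses some point.\<close>
  have "negligible (\<Union>a\<in>?A. {x. a \<bullet> x = 0})"
    using assms \<open>e \<noteq> 0\<close> by (intro negligible_Union) (auto intro!: negligible_hyperplane)
  then have "(\<Union>a\<in>?A. {x. a \<bullet> x = 0}) \<noteq> UNIV"
    using non_negligible_UNIV by metis
  then obtain u where u: "\<forall>a\<in>?A. a \<bullet> u \<noteq> 0" by auto
  then have "u \<noteq> 0" by auto
  with u have "norm (sgn u) = 1 \<and> (\<forall>a\<in>A. sgn u \<bullet> a \<noteq> 0)"
    by (simp add: norm_sgn sgn_div_norm inner_commute)
  then show ?thesis ..
qed

lemma proj_sep_pos:
  fixes z :: "nat \<Rightarrow> real ^ 'n::finite"
  assumes "s \<ge> 2" "inj_on z {1..s}" "j \<in> {1..s}"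
  shows "proj_sep z s j > 0"
proof -
  let ?I = "{1..s} - {j}"
  have "z j \<noteq> z i" if "i \<in> ?I" for i
    using inj_onD[OF assms(2), of j i] assms(3) that by blast
  then have "0 \<notin> (\<lambda>i. z j - z i) ` ?I"
    by force
  then obtain w where w: "norm w = 1" "\<forall>i\<in>?I. w \<bullet> (z j - z i) \<noteq> 0"
    using exists_nonorthogonal_unit_vector[of "(\<lambda>i. z j - z i) ` ?I"] by auto
  have "card ?I \<noteq> 0" using assms by simp
  then have "?I \<noteq> {}" by (metis card.empty)
  with w have "0 < min_proj z s j w"
    unfolding min_proj_def by (subst Min_gr_iff) auto
  also have "\<dots> \<le> proj_sep z s j"
    using proj_sep_attained[OF assms(1), of z j] w(1) by metis
  finally show ?thesis .
qed

theorem lemma2p2: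
  fixes z :: "nat \<Rightarrow> real ^ 'n::finite" and s N :: nat
  assumes "s \<ge> 2"
    and "z ` {1..s} \<subseteq> cball 0 1"
    and "inj_on z {1..s}"
    and "N \<ge> s - 1"
  shows "\<forall>j\<in>{1..s}. \<exists>Q\<in>mpoly_space N.
           (\<forall>i\<in>{1..s}. mpoly_eval Q (z i) = (if i = j then 1 else 0)) \<and>
           coeff_norm N Q \<le> real s * (4 * real CARD('n) / proj_sep z s j) ^ (s - 1)"
proof
  fix j assume j: "j \<in> {1..s}"
  let ?I = "{1..s} - {j}" and ?n = "real CARD('n)" and ?r = "proj_sep z s j"
  have r: "?r > 0" using proj_sep_pos assms(1,3) j by blast
  have cardI: "card ?I = s - 1" using j by simp
  obtain v where v: "norm v = 1" "?r = min_proj z s j v"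
    using proj_sep_attained[OF assms(1)] by metis
  define d where "d i = v \<bullet> (z j - z i)" for i
  have rd: "?r \<le> \<bar>d i\<bar>" if "i \<in> ?I" for i
    unfolding v(2) min_proj_def d_def using that by (intro Min_le) auto
  \<comment> \<open>Dividing by \<open>d i\<close> inside the coefficients makes the factor 0 at
    \<open>z i\<close> and 1 at \<open>z j\<close>.\<close>
  define F where "F i = affine_mpoly (v /\<^sub>R d i) (- (v \<bullet> z i) / d i)" for i
  have evalF: "mpoly_eval (F i) x = v \<bullet> (x - z i) / d i" for i x
    by (simp add: F_def inner_diff_right divide_inverse algebra_simps)
  have normF: "l1_norm (F i) \<le> 4 * ?n / ?r" if i: "i \<in> ?I" for i
  proof -
    have n: "1 \<le> ?n" by (simp add: Suc_leI)
    have "(\<Sum>l\<in>UNIV. \<bar>v $ l\<bar>) \<le> ?n"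
      using sum_bounded_above[of UNIV "\<lambda>l. \<bar>v $ l\<bar>" 1] component_le_norm_cart[of v] v(1) by simp
    moreover have "\<bar>v \<bullet> z i\<bar> \<le> 1"
    proof -
      have "norm (z i) \<le> 1" using assms(2) i by (auto simp: image_subset_iff)
      then show ?thesis using Cauchy_Schwarz_ineq2[of v "z i"] v(1) by simp
    qed
    \<comment> \<open>The left side is at most \<open>?n + 1\<close>, hence at most
      \<open>2 * ?n\<close>; the constant 4 leaves slack.\<close>
    ultimately have num: "(\<Sum>l\<in>UNIV. \<bar>v $ l\<bar>) + \<bar>v \<bullet> z i\<bar> \<le> 4 * ?n" using n by linarith
    have "l1_norm (F i) \<le> (\<Sum>l\<in>UNIV. \<bar>(v /\<^sub>R d i) $ l\<bar>) + \<bar>- (v \<bullet> z i) / d i\<bar>"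
      unfolding F_def by (rule l1_norm_affine)
    also have "\<dots> = ((\<Sum>l\<in>UNIV. \<bar>v $ l\<bar>) + \<bar>v \<bullet> z i\<bar>) / \<bar>d i\<bar>"
      by (simp add: abs_mult divide_inverse distrib_left sum_distrib_left mult.commute)
    also have "\<dots> \<le> 4 * ?n / ?r"
      using num rd[OF i] r by (intro frac_le) auto
    finally show ?thesis .
  qed
  let ?Q = "\<Prod>i\<in>?I. F i"
  have "?Q \<in> mpoly_space (card ?I)"
    by (rule mpoly_space_prod) (simp only: F_def affine_in_mpoly_space)
  then have "?Q \<in> mpoly_space N"
    using mpoly_space_mono[OF assms(4)] unfolding cardI by blast
  moreover have "mpoly_eval ?Q (z i) = (if i = j then 1 else 0)" if "i \<in> {1..s}" for i
  proof (cases "i = j")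
    case True
    \<comment> \<open>Needed because division by zero yields 0, which would spoil the value 1 at
      \<open>z j\<close>.\<close>
    have "d k \<noteq> 0" if "k \<in> ?I" for k using rd[OF that] r by auto
    then have "(\<Prod>k\<in>?I. v \<bullet> (z j - z k) / d k) = 1"
      by (intro prod.neutral) (simp add: d_def)
    with True show ?thesis by (simp add: mpoly_eval_prod evalF)
  next
    case False
    \<comment> \<open>As \<open>i\<close> differs from \<open>j\<close>, it is itself an index of
      the product, and its factor vanishes at \<open>z i\<close>.\<close>
    with that have "(\<Prod>k\<in>?I. v \<bullet> (z i - z k) / d k) = 0"
      by (intro prod_zero bexI[of _ i]) auto
    with False show ?thesis by (simp add: mpoly_eval_prod evalF)
  qed
  moreover have "coeff_norm N ?Q \<le> real s * (4 * ?n / ?r) ^ (s - 1)"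
  proof -
    have "coeff_norm N ?Q \<le> (\<Prod>i\<in>?I. l1_norm (F i))"
      by (rule order_trans[OF coeff_norm_le_l1_norm l1_norm_prod])
    also have "\<dots> \<le> (\<Prod>i\<in>?I. 4 * ?n / ?r)"
      by (intro prod_mono conjI l1_norm_nonneg normF)
    also have "\<dots> = (4 * ?n / ?r) ^ (s - 1)"
      by (simp only: prod_constant cardI)
    \<comment> \<open>The power is nonnegative and \<open>s\<close> is at least 1, so the factor
      \<open>s\<close> only enlarges the bound.\<close>
    also have "\<dots> \<le> real s * (4 * ?n / ?r) ^ (s - 1)"
      using mult_right_mono[of 1 "real s" "(4 * ?n / ?r) ^ (s - 1)"] assms(1) r by simp
    finally show ?thesis .
  qed
  ultimately show "\<exists>Q\<in>mpoly_space N.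
           (\<forall>i\<in>{1..s}. mpoly_eval Q (z i) = (if i = j then 1 else 0)) \<and>
           coeff_norm N Q \<le> real s * (4 * ?n / ?r) ^ (s - 1)"
    by blast
qed

end
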